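(* Let $\alpha \in (0,1)$ and let $I \subseteq \mathbb{R}$ be a (nondegenerate) interval. The $\mathrm{CVaR}_\alpha$ functional is not elicitable relative to any class $\mathcal{F}$ of probability distributions on $I$ (on which $\mathrm{CVaR}_\alpha$ is defined) that contains the measures with finite support in $I$, or that contains the finite mixtures of the absolutely continuous distributions with compact support in $I$.
   Context: For $0 < \alpha < 1$, the $\alpha$-conditional value-at-risk functional is $$\mathrm{CVaR}_\alpha(F) = \frac{1}{1-\alpha} \int_\alpha^1 q_\beta(F)\, d\beta,$$ where $q_\beta(F)$ denotes the $\beta$-quantile of $F$, that is, any number $x$ with $\lim_{y \uparrow x} F(y) \le \beta \le F(x)$, $F$ being identified with its cumulative distribution function (non-uniqueness of the quantile does not affect the integral). Absolute continuity is with respect to Lebesgue measure. A scoring function is a map $S : I \times I \to [0,\infty)$ (point forecast $x$ first, observation $y$ second), measurable in the second argument, so that $\mathbb{E}_F S(x,Y) \in [0,\infty]$ is defined, where $Y$ has distribution $F$. For a class $\mathcal{F}$ of probability measures on $I$ and a functional $T : \mathcal{F} \to I$, $S$ is strictly consistent for $T$ relative to $\mathcal{F}$ if $\mathbb{E}_F S(T(F),Y) \le \mathbb{E}_F S(x,Y)$ for all $F \in \mathcal{F}$ and all $x \in I$, and equality implies that $x = T(F)$. The functional $T$ is elicitable relative to $\mathcal{F}$ if there exists a scoring function that is strictly consistent for $T$ relative to $\mathcal{F}$. *)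

theory Defs
  imports "HOL-Probability.Probability"
begin

text \<open>A probability measure on \<open>I\<close> is represented as a Borel probability measure on the whole
  real line that gives \<open>I\<close> full mass, so that the library's \<^const>\<open>cdf\<close> applies to it.\<close>

definition distributions_on :: "real set \<Rightarrow> real measure set" where
  "distributions_on I = {M. real_distribution M \<and> measure M I = 1}"

definition measure_support :: "real measure \<Rightarrow> real set" where
  "measure_support M = {x. \<forall>U. open U \<and> x \<in> U \<longrightarrow> measure M U > 0}"

definition finite_support_distributions :: "real set \<Rightarrow> real measure set" where
  "finite_support_distributions I =
     {M \<in> distributions_on I. finite (measure_support M) \<and> measure_support M \<subseteq> I}"

definition ac_compact_support_distributions :: "real set \<Rightarrow> real measure set" where
  "ac_compact_support_distributions I =
     {M \<in> distributions_on I. absolutely_continuous lborel M \<and>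
        compact (measure_support M) \<and> measure_support M \<subseteq> I}"

definition finite_mixtures :: "real measure set \<Rightarrow> real measure set" where
  "finite_mixtures C =
     {M. sets M = sets borel \<and>
        (\<exists>(n::nat) (w :: nat \<Rightarrow> real) (N :: nat \<Rightarrow> real measure).
           (\<forall>i<n. 0 \<le> w i \<and> N i \<in> C) \<and> (\<Sum>i<n. w i) = 1 \<and>
           (\<forall>A\<in>sets borel. emeasure M A = (\<Sum>i<n. ennreal (w i) * emeasure (N i) A)))}"

definition is_quantile :: "real measure \<Rightarrow> real \<Rightarrow> real \<Rightarrow> bool" where
  "is_quantile M \<beta> x \<longleftrightarrow> Lim (at_left x) (cdf M) \<le> \<beta> \<and> \<beta> \<le> cdf M x"

text \<open>An arbitrary choice of quantile. For a real distribution a \<open>\<beta>\<close>-quantile exists for every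
  \<open>\<beta>\<close> in the open unit interval; every choice is nondecreasing in \<open>\<beta>\<close>, and two choices differ for
  at most countably many \<open>\<beta>\<close>, so the choice does not affect the integral below.\<close>

definition quantile :: "real measure \<Rightarrow> real \<Rightarrow> real" where
  "quantile M \<beta> = (SOME x. is_quantile M \<beta> x)"

definition CVaR :: "real \<Rightarrow> real measure \<Rightarrow> real" where
  "CVaR \<alpha> M = 1 / (1 - \<alpha>) * (LBINT \<beta>:{\<alpha><..<1}. quantile M \<beta>)"

text \<open>The Bochner integral of a non-integrable function is \<open>0\<close> by convention, so finiteness of
  the integral defining \<^const>\<open>CVaR\<close> has to be demanded separately.\<close>

definition CVaR_defined :: "real \<Rightarrow> real measure \<Rightarrow> bool" where
  "CVaR_defined \<alpha> M \<longleftrightarrow> set_integrable lborel {\<alpha><..<1} (quantile M)"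

text \<open>A score \<open>S x y\<close> has the point forecast \<open>x\<close> first and the observation \<open>y\<close> second; its values
  for arguments outside \<open>I\<close> are irrelevant.\<close>

definition scoring_function :: "real set \<Rightarrow> (real \<Rightarrow> real \<Rightarrow> real) \<Rightarrow> bool" where
  "scoring_function I S \<longleftrightarrow>
     (\<forall>x\<in>I. \<forall>y\<in>I. 0 \<le> S x y) \<and> (\<forall>x\<in>I. S x \<in> borel_measurable (restrict_space borel I))"

definition expected_score ::
    "real set \<Rightarrow> (real \<Rightarrow> real \<Rightarrow> real) \<Rightarrow> real measure \<Rightarrow> real \<Rightarrow> ennreal" where
  "expected_score I S F x = (\<integral>\<^sup>+y\<in>I. ennreal (S x y) \<partial>F)"

text \<open>Only meant for functionals \<open>T\<close> with values in \<open>I\<close> on \<open>\<F>\<close>. For \<^const>\<open>CVaR\<close> and an interval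
  \<open>I\<close> this is automatic: quantiles of level in the open unit interval of a distribution on \<open>I\<close> lie
  in \<open>I\<close>, and so do their averages.\<close>

definition strictly_consistent ::
    "real set \<Rightarrow> real measure set \<Rightarrow> (real measure \<Rightarrow> real) \<Rightarrow> (real \<Rightarrow> real \<Rightarrow> real) \<Rightarrow> bool" where
  "strictly_consistent I \<F> T S \<longleftrightarrow>
     (\<forall>F\<in>\<F>. \<forall>x\<in>I. expected_score I S F (T F) \<le> expected_score I S F x \<and>
        (expected_score I S F (T F) = expected_score I S F x \<longrightarrow> x = T F))"

definition elicitable :: "real set \<Rightarrow> real measure set \<Rightarrow> (real measure \<Rightarrow> real) \<Rightarrow> bool" where
  "elicitable I \<F> T \<longleftrightarrow> (\<exists>S. scoring_function I S \<and> strictly_consistent I \<F> T S)"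

end

theory Submission
  imports Defs
begin

text \<open>
  An elicitable functional has convex level sets: if it takes the same value \<open>t\<close> at \<open>F\<close> and at
  \<open>G\<close>, it takes the value \<open>t\<close> at every mixture of the two, because the expected score is
  affine in the distribution and \<open>t\<close> is its strict minimiser for both components
  (\<open>strictly_consistent_mixture\<close>). So it suffices to find, in the given class, two distributions
  with equal conditional value-at-risk that have a mixture with a different one.

  That CVaR behaves differently is seen from the formula of Rockafellar and Uryasev: CVaR is the
  minimum over \<open>x\<close> of \<open>x + E max(0, Y - x) / (1 - \<alpha>)\<close>, and the minimisers are exactly the
  \<open>\<alpha>\<close>-quantiles (\<open>CVaR_eq_ru_objective\<close>, \<open>CVaR_le_ru_objective\<close>, \<open>CVaR_less_ru_objective\<close>).
  For fixed \<open>x\<close> the objective is affine in the distribution, so its minimum is concave; evaluating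
  it at an \<open>\<alpha>\<close>-quantile of the mixture shows that the CVaR of a mixture of \<open>F\<close> and \<open>G\<close>
  strictly exceeds their common CVaR as soon as \<open>F\<close> and \<open>G\<close> have no common \<open>\<alpha>\<close>-quantile
  (\<open>CVaR_mixture_greater\<close>).

  It remains to give such pairs. In an interval \<open>[a, b]\<close> with \<open>a < b\<close>, the point mass at the
  midpoint has the same CVaR as the two-point distribution with mass \<open>(1 + \<alpha>) / 2\<close> at \<open>a\<close> and
  the rest at \<open>b\<close>, but the \<open>\<alpha>\<close>-quantile of the latter is \<open>a\<close>. Among absolutely continuous
  distributions one can take two uniform distributions on intervals of different length: the
  distance between the \<open>\<alpha>\<close>-quantile and the CVaR of a uniform distribution is proportional to the
  length, so if the CVaRs agree then the quantiles do not.
\<close>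

section \<open>Quantiles\<close>

lemma is_quantile_iff:
  assumes "real_distribution M"
  shows "is_quantile M \<beta> x \<longleftrightarrow> measure M {..<x} \<le> \<beta> \<and> \<beta> \<le> measure M {..x}"
proof -
  interpret real_distribution M by fact
  have "Lim (at_left x) (cdf M) = measure M {..<x}"
    by (intro tendsto_Lim cdf_at_left) simp
  then show ?thesis
    by (simp add: is_quantile_def cdf_def)
qed

lemma is_quantile_mono:
  assumes "real_distribution M" "is_quantile M \<beta> x" "is_quantile M \<gamma> y" "\<beta> < \<gamma>"
  shows "x \<le> y"
proof (rule ccontr)
  interpret real_distribution M by fact
  assume "\<not> x \<le> y"
  then have "measure M {..y} \<le> measure M {..<x}"
    by (intro finite_measure_mono) auto
  with assms show False
    by (simp add: is_quantile_iff)
qed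

lemma is_quantile_quantile:
  assumes "real_distribution M" "0 < \<beta>" "\<beta> < 1"
  shows "is_quantile M \<beta> (quantile M \<beta>)"
proof -
  interpret real_distribution M by fact
  interpret cdf_distribution M by unfold_locales
  \<comment> \<open>Here \<open>I\<close> denotes the lower quantile function of the locale for cumulative distribution functions.\<close>
  have below: "cdf M y \<le> \<beta>" if "y < I \<beta>" for y
    using pseudoinverse[of \<beta> y] assms that by linarith
  have "measure M {..<I \<beta>} \<le> \<beta>"
    by (rule tendsto_upperbound[OF cdf_at_left])
       (auto intro!: below simp: eventually_at_left_field intro: exI[of _ "I \<beta> - 1"])
  moreover have "\<beta> \<le> measure M {..I \<beta>}"
    using pseudoinverse[of \<beta> "I \<beta>"] assms by (simp add: cdf_def)
  ultimately have "is_quantile M \<beta> (I \<beta>)"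
    by (simp add: is_quantile_iff[OF assms(1)])
  then show ?thesis
    unfolding quantile_def by (rule someI)
qed

lemma mono_on_quantile:
  assumes "real_distribution M"
  shows "mono_on {0<..<1} (quantile M)"
proof (rule mono_onI)
  fix \<beta> \<gamma> :: real
  assume "\<beta> \<in> {0<..<1}" "\<gamma> \<in> {0<..<1}" "\<beta> \<le> \<gamma>"
  then show "quantile M \<beta> \<le> quantile M \<gamma>"
    using is_quantile_mono[OF assms is_quantile_quantile[OF assms] is_quantile_quantile[OF assms]]
    by (cases "\<beta> = \<gamma>") auto
qed

lemma measurable_quantile [measurable]:
  "real_distribution M \<Longrightarrow> quantile M \<in> borel_measurable (restrict_space lborel {0<..<1})"
  using borel_measurable_mono_on_fnc[OF mono_on_quantile]
  by (simp cong: measurable_cong_sets restrict_space_sets_cong)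

text \<open>The quantile transform holds for the arbitrary choice of quantiles made by
  \<^const>\<open>quantile\<close>: up to the single level \<open>\<beta> = cdf M x\<close>, the condition \<open>quantile M \<beta> \<le> x\<close>
  means \<open>\<beta> \<le> cdf M x\<close>, and one level is a Lebesgue null set.\<close>

lemma distr_quantile:
  assumes "real_distribution M"
  shows "distr (restrict_space lborel {0<..<1::real}) borel (quantile M) = M" (is "?D = _")
proof (rule cdf_unique)
  interpret real_distribution M by fact
  let ?\<Omega> = "restrict_space lborel {0<..<1}::real measure"
  interpret \<Omega>: prob_space ?\<Omega>
    by (auto simp add: emeasure_restrict_space space_restrict_space intro!: prob_spaceI)
  show "real_distribution ?D" "real_distribution M"
    using assms by auto
  have "cdf ?D x = cdf M x" for x
  proof -
    have quantile_le: "quantile M \<beta> \<le> x \<longleftrightarrow> \<beta> \<le> cdf M x"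
      if "\<beta> \<in> {0<..<1}" "\<beta> \<noteq> cdf M x" for \<beta>
    proof -
      have q: "measure M {..<quantile M \<beta>} \<le> \<beta>" "\<beta> \<le> cdf M (quantile M \<beta>)"
        using is_quantile_quantile[OF assms, of \<beta>] that
        by (auto simp: is_quantile_iff[OF assms] cdf_def)
      have "cdf M (quantile M \<beta>) \<le> cdf M x" if "quantile M \<beta> \<le> x"
        using that by (rule cdf_nondecreasing)
      moreover have "cdf M x \<le> measure M {..<quantile M \<beta>}" if "\<not> quantile M \<beta> \<le> x"
        using that by (auto simp: cdf_def intro!: finite_measure_mono)
      ultimately show ?thesis
        using q that(2) by fastforce
    qed
    have "cdf ?D x = measure ?\<Omega> {\<beta>\<in>{0<..<1}. quantile M \<beta> \<le> x}"
      using assms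
      by (subst cdf_def)
         (auto simp: measure_distr space_restrict_space intro!: arg_cong2[where f="measure"])
    also have "\<dots> = measure ?\<Omega> ({0<..<1} \<inter> {..cdf M x})"
    proof (rule \<Omega>.finite_measure_eq_AE)
      have "AE \<beta> in ?\<Omega>. \<beta> \<in> {0<..<1} \<and> \<beta> \<noteq> cdf M x"
        using AE_lborel_singleton[of "cdf M x"]
        by (subst AE_restrict_space_iff) (auto elim!: eventually_mono)
      then show "AE \<beta> in ?\<Omega>. (\<beta> \<in> {\<beta>\<in>{0<..<1}. quantile M \<beta> \<le> x}) =
          (\<beta> \<in> {0<..<1} \<inter> {..cdf M x})"
        by eventually_elim (simp add: quantile_le)
      have "{\<beta> \<in> space ?\<Omega>. quantile M \<beta> \<le> x} \<in> sets ?\<Omega>"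
        using measurable_quantile[OF assms] by measurable
      then show "{\<beta>\<in>{0<..<1}. quantile M \<beta> \<le> x} \<in> sets ?\<Omega>"
        by simp
      show "{0<..<1} \<inter> {..cdf M x} \<in> sets ?\<Omega>"
        by (simp add: sets_restrict_space_iff)
    qed
    also have "\<dots> = measure lborel ({0<..<1} \<inter> {..cdf M x})"
      by (subst measure_restrict_space) auto
    also have "\<dots> = measure lborel {0<..<cdf M x}"
      using cdf_bounded_prob[of x] AE_lborel_singleton[of "cdf M x"]
      by (auto intro!: arg_cong[where f=enn2real] emeasure_eq_AE simp: measure_def)
    also have "\<dots> = cdf M x"
      by (simp add: cdf_nonneg)
    finally show ?thesis .
  qed
  then show "cdf ?D = cdf M" by blast
qed

section \<open>Conditional value-at-risk as a strict minimum\<close>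

text \<open>The objective function of Rockafellar and Uryasev.\<close>

definition ru_objective :: "real \<Rightarrow> real measure \<Rightarrow> real \<Rightarrow> real" where
  "ru_objective \<alpha> M x = x + (\<integral>y. max 0 (y - x) \<partial>M) / (1 - \<alpha>)"

lemma integrable_excess:
  assumes "real_distribution M" "integrable M (\<lambda>y. max 0 y)"
  shows "integrable M (\<lambda>y. max 0 (y - x))"
proof -
  interpret real_distribution M by fact
  show ?thesis
    by (rule Bochner_Integration.integrable_bound[where f="\<lambda>y. max 0 y + \<bar>x\<bar>"])
       (use assms in \<open>auto intro!: AE_I2\<close>)
qed

text \<open>Rewrite the expectation on the right as an integral of quantiles over all levels. Levels
  below \<open>\<alpha>\<close> contribute nothing because their quantiles are at most \<open>q\<close>; for levels above
  \<open>\<alpha>\<close> the quantile is at least \<open>q\<close> and so equals \<open>q\<close> plus its excess over \<open>q\<close>.\<close>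

lemma CVaR_eq_ru_objective:
  assumes M: "real_distribution M" "integrable M (\<lambda>y. max 0 y)"
    and \<alpha>: "0 < \<alpha>" "\<alpha> < 1" and q: "is_quantile M \<alpha> q"
  shows "CVaR \<alpha> M = ru_objective \<alpha> M q"
proof -
  let ?\<Omega> = "restrict_space lborel {0<..<1}::real measure"
  let ?f = "\<lambda>y. max 0 (y - q)"
  interpret real_distribution M by fact
  have quantile_side: "(\<beta> < \<alpha> \<longrightarrow> quantile M \<beta> \<le> q) \<and> (\<alpha> < \<beta> \<longrightarrow> q \<le> quantile M \<beta>)"
    if "0 < \<beta>" "\<beta> < 1" for \<beta>
    using is_quantile_mono[OF M(1)] is_quantile_quantile[OF M(1) that] q by blast
  have int: "integrable ?\<Omega> (\<lambda>\<beta>. ?f (quantile M \<beta>))"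
    using integrable_excess[OF M] M(1)
    by (subst (asm) distr_quantile[OF M(1), symmetric]) (simp add: integrable_distr_eq)
  have "(\<integral>y. ?f y \<partial>M) = (\<integral>\<beta>. ?f (quantile M \<beta>) \<partial>?\<Omega>)"
    using M(1) by (subst distr_quantile[OF M(1), symmetric]) (simp add: integral_distr)
  also have "\<dots> = (\<integral>\<beta>. indicator {0<..<1} \<beta> *\<^sub>R ?f (quantile M \<beta>) \<partial>lborel)"
    by (simp add: integral_restrict_space)
  finally have excess: "(\<integral>y. ?f y \<partial>M) = \<dots>" .
  have int': "integrable lborel (\<lambda>\<beta>. indicator {0<..<1} \<beta> *\<^sub>R ?f (quantile M \<beta>))"
    using int by (simp add: integrable_restrict_space)
  have AE: "AE \<beta> in lborel. indicator {\<alpha><..<1} \<beta> *\<^sub>R quantile M \<beta> =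
      indicator {\<alpha><..<1} \<beta> *\<^sub>R q + indicator {0<..<1} \<beta> *\<^sub>R ?f (quantile M \<beta>)"
    using AE_lborel_singleton[of \<alpha>]
  proof eventually_elim
    case (elim \<beta>)
    then show ?case
      using \<alpha> quantile_side[of \<beta>] by (auto simp: indicator_def)
  qed
  have meas: "(\<lambda>\<beta>. indicator {\<alpha><..<1} \<beta> *\<^sub>R quantile M \<beta>) \<in> borel_measurable lborel"
  proof -
    have "(\<lambda>\<beta>. indicator {0<..<1} \<beta> *\<^sub>R quantile M \<beta>) \<in> borel_measurable lborel"
      by (rule borel_measurable_restrict_space_iff[THEN iffD1, OF _ measurable_quantile[OF M(1)]])
         simp
    then have "(\<lambda>\<beta>. indicator {\<alpha><..<1} \<beta> *\<^sub>R (indicator {0<..<1} \<beta> *\<^sub>R quantile M \<beta>))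
        \<in> borel_measurable lborel"
      by (rule borel_measurable_scaleR[rotated]) simp
    also have "(\<lambda>\<beta>. indicator {\<alpha><..<1} \<beta> *\<^sub>R (indicator {0<..<1} \<beta> *\<^sub>R quantile M \<beta>)) =
        (\<lambda>\<beta>. indicator {\<alpha><..<1} \<beta> *\<^sub>R quantile M \<beta>)"
      using \<alpha> by (auto simp: indicator_def fun_eq_iff)
    finally show ?thesis .
  qed
  have "(LBINT \<beta>:{\<alpha><..<1}. quantile M \<beta>) =
      (\<integral>\<beta>. indicator {\<alpha><..<1} \<beta> *\<^sub>R q + indicator {0<..<1} \<beta> *\<^sub>R ?f (quantile M \<beta>) \<partial>lborel)"
    unfolding set_lebesgue_integral_def
    using AE meas int' by (intro integral_cong_AE borel_measurable_add) auto
  also have "\<dots> = (1 - \<alpha>) * q + (\<integral>y. ?f y \<partial>M)"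
    unfolding excess using int' \<alpha> by (subst Bochner_Integration.integral_add) auto
  finally show ?thesis
    using \<alpha> by (simp add: CVaR_def ru_objective_def field_simps)
qed

text \<open>For each \<open>y\<close> the map sending \<open>x\<close> to \<open>max 0 (y - x)\<close> is convex, and both minus the
  indicator of \<open>x < y\<close> and minus the indicator of \<open>x \<le> y\<close> are subgradients of it at \<open>x\<close>.
  Integrating the two subgradient inequalities gives the two claims.\<close>

lemma ru_objective_subgradient:
  assumes M: "real_distribution M" "integrable M (\<lambda>y. max 0 y)" and \<alpha>: "\<alpha> < 1"
  shows "ru_objective \<alpha> M x + (z - x) * (measure M {..x} - \<alpha>) / (1 - \<alpha>) \<le> ru_objective \<alpha> M z"
    and "ru_objective \<alpha> M x + (z - x) * (measure M {..<x} - \<alpha>) / (1 - \<alpha>) \<le> ru_objective \<alpha> M z"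
proof -
  interpret real_distribution M by fact
  \<comment> \<open>Both subgradients have the form \<open>indicator A y - 1\<close>, differing only in whether \<open>x\<close> is in \<open>A\<close>.\<close>
  have *: "ru_objective \<alpha> M x + (z - x) * (measure M A - \<alpha>) / (1 - \<alpha>) \<le> ru_objective \<alpha> M z"
    if A: "A \<in> sets borel" "{..<x} \<subseteq> A" "A \<subseteq> {..x}" for A
  proof -
    have int: "integrable M (indicator A :: real \<Rightarrow> real)"
      using A(1) by (intro integrable_real_indicator) (auto simp: emeasure_eq_measure)
    have "(\<integral>y. max 0 (y - x) - (z - x) * (1 - indicator A y) \<partial>M) \<le> (\<integral>y. max 0 (y - z) \<partial>M)"
    proof (rule integral_mono)
      show "max 0 (y - x) - (z - x) * (1 - indicator A y) \<le> max 0 (y - z)" for y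
        using A(2,3) by (cases "y < x"; cases "y = x") (auto simp: indicator_def)
    qed (use A int integrable_excess[OF M] in
          \<open>auto intro!: Bochner_Integration.integrable_diff integrable_mult_right\<close>)
    also have "(\<integral>y. max 0 (y - x) - (z - x) * (1 - indicator A y) \<partial>M)
        = (\<integral>y. max 0 (y - x) \<partial>M) - (z - x) * (1 - measure M A)"
      using A int integrable_excess[OF M]
      by (subst Bochner_Integration.integral_diff)
         (auto intro!: Bochner_Integration.integrable_diff integrable_mult_right
           simp: prob_space[simplified])
    finally have "((\<integral>y. max 0 (y - x) \<partial>M) - (z - x) * (1 - measure M A)) / (1 - \<alpha>)
        \<le> (\<integral>y. max 0 (y - z) \<partial>M) / (1 - \<alpha>)"
      using \<alpha> by (intro divide_right_mono) auto
    moreover have affine: "e / (1 - \<alpha>) + (z - x) * (m - \<alpha>) / (1 - \<alpha>)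
        = (z - x) + (e - (z - x) * (1 - m)) / (1 - \<alpha>)" for e m :: real
    proof -
      have "e + (z - x) * (m - \<alpha>) = (z - x) * (1 - \<alpha>) + (e - (z - x) * (1 - m))"
        by (simp add: algebra_simps)
      then show ?thesis
        using \<alpha> by (simp add: add_divide_distrib[symmetric] divide_add_eq_iff add_divide_eq_iff)
    qed
    ultimately show ?thesis
      using affine[of "\<integral>y. max 0 (y - x) \<partial>M" "measure M A"]
      unfolding ru_objective_def by linarith
  qed
  show "ru_objective \<alpha> M x + (z - x) * (measure M {..x} - \<alpha>) / (1 - \<alpha>) \<le> ru_objective \<alpha> M z"
    by (rule *) auto
  show "ru_objective \<alpha> M x + (z - x) * (measure M {..<x} - \<alpha>) / (1 - \<alpha>) \<le> ru_objective \<alpha> M z"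
    by (rule *) auto
qed

text \<open>At a quantile \<open>q\<close> one of the two subgradients is nonnegative and the other nonpositive,
  so \<open>q\<close> is a minimiser.\<close>

lemma CVaR_le_ru_objective:
  assumes M: "real_distribution M" "integrable M (\<lambda>y. max 0 y)" and \<alpha>: "0 < \<alpha>" "\<alpha> < 1"
  shows "CVaR \<alpha> M \<le> ru_objective \<alpha> M z"
proof -
  define q where "q = quantile M \<alpha>"
  have q: "is_quantile M \<alpha> q"
    unfolding q_def using is_quantile_quantile[OF M(1) \<alpha>] .
  then have le: "measure M {..<q} \<le> \<alpha>" "\<alpha> \<le> measure M {..q}"
    by (auto simp: is_quantile_iff[OF M(1)])
  have "0 \<le> (z - q) * (measure M {..q} - \<alpha>) / (1 - \<alpha>) \<or>
      0 \<le> (z - q) * (measure M {..<q} - \<alpha>) / (1 - \<alpha>)"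
    using le \<alpha> by (cases "q \<le> z") (auto intro!: divide_nonneg_pos mult_nonneg_nonneg mult_nonpos_nonpos)
  then show ?thesis
    using ru_objective_subgradient[OF M \<alpha>(2), of q z] CVaR_eq_ru_objective[OF M \<alpha> q] by linarith
qed

text \<open>If \<open>z\<close> is not a quantile, at some \<open>r\<close> the objective has a subgradient that increases
  towards \<open>z\<close>, so the value at \<open>z\<close> strictly exceeds the one at \<open>r\<close>, which is at least the
  minimum. The point \<open>r\<close> lies to the right of \<open>z\<close> if the distribution function at \<open>z\<close> is
  below \<open>\<alpha>\<close> (right continuity), and to the left if its left limit at \<open>z\<close> is above \<open>\<alpha>\<close>.\<close>

lemma CVaR_less_ru_objective:
  assumes M: "real_distribution M" "integrable M (\<lambda>y. max 0 y)" and \<alpha>: "0 < \<alpha>" "\<alpha> < 1"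
    and z: "\<not> is_quantile M \<alpha> z"
  shows "CVaR \<alpha> M < ru_objective \<alpha> M z"
proof -
  interpret real_distribution M by fact
  obtain r where r: "0 < (z - r) * (measure M {..r} - \<alpha>)"
  proof (cases "measure M {..z} < \<alpha>")
    case True
    have "(cdf M \<longlongrightarrow> cdf M z) (at_right z)"
      using cdf_is_right_cont[of z] by (simp add: continuous_within)
    then have "eventually (\<lambda>r. cdf M r < \<alpha>) (at_right z)"
      using True by (intro order_tendstoD(2)) (auto simp: cdf_def)
    then have "eventually (\<lambda>r. cdf M r < \<alpha> \<and> z < r) (at_right z)"
      using eventually_at_right_less by (rule eventually_conj)
    then obtain r where "cdf M r < \<alpha>" "z < r"
      using eventually_happens'[OF trivial_limit_at_right_real] by blast
    then show thesis
      by (intro that[of r]) (auto simp: cdf_def intro!: mult_neg_neg)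
  next
    case False
    with z have "\<alpha> < measure M {..<z}"
      by (auto simp: is_quantile_iff[OF M(1)])
    then have "eventually (\<lambda>r. \<alpha> < cdf M r) (at_left z)"
      by (intro order_tendstoD(1)[OF cdf_at_left])
    then have "eventually (\<lambda>r. \<alpha> < cdf M r \<and> r < z) (at_left z)"
      by (rule eventually_conj) (auto simp: eventually_at_filter)
    then obtain r where "\<alpha> < cdf M r" "r < z"
      using eventually_happens'[OF trivial_limit_at_left_real] by blast
    then show thesis
      by (intro that[of r]) (auto simp: cdf_def)
  qed
  then have "0 < (z - r) * (measure M {..r} - \<alpha>) / (1 - \<alpha>)"
    using \<alpha> by (intro divide_pos_pos) auto
  with ru_objective_subgradient(1)[OF M \<alpha>(2), of r z] CVaR_le_ru_objective[OF M \<alpha>, of r]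
  show ?thesis by linarith
qed

lemma integrable_max_if_bounded_above:
  assumes "real_distribution M" "AE y in M. y \<le> v"
  shows "integrable M (\<lambda>y. max 0 y)"
proof -
  interpret real_distribution M by fact
  show ?thesis
    using assms(2) by (intro integrable_const_bound[where B="\<bar>v\<bar>"]) (auto elim!: eventually_mono)
qed

text \<open>The lower bound holds since CVaR is at least the quantile; the upper one follows by taking
  \<open>v\<close> as a competitor in the minimisation, where the expected excess vanishes.\<close>

lemma CVaR_in_interval:
  assumes M: "real_distribution M" "AE y in M. y \<in> {u..v}" and \<alpha>: "0 < \<alpha>" "\<alpha> < 1"
  shows "CVaR \<alpha> M \<in> {u..v}"
proof -
  interpret real_distribution M by fact
  have int: "integrable M (\<lambda>y. max 0 y)"
    using M by (intro integrable_max_if_bounded_above[of M v]) (auto elim!: eventually_mono)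
  define q where "q = quantile M \<alpha>"
  have q: "is_quantile M \<alpha> q"
    unfolding q_def using is_quantile_quantile[OF M(1) \<alpha>] .
  have "u \<le> q"
  proof (rule ccontr)
    assume "\<not> u \<le> q"
    then have "measure M {..q} = 0"
      using M(2) by (intro measure_eq_0_null_sets AE_iff_null_sets[THEN iffD2])
         (auto elim!: eventually_mono)
    with q \<alpha> show False by (simp add: is_quantile_iff[OF M(1)])
  qed
  moreover have "0 \<le> (\<integral>y. max 0 (y - q) \<partial>M) / (1 - \<alpha>)"
    using \<alpha> by (intro divide_nonneg_pos integral_nonneg) auto
  ultimately have "u \<le> CVaR \<alpha> M"
    using CVaR_eq_ru_objective[OF M(1) int \<alpha> q] by (simp add: ru_objective_def)
  moreover have "AE y in M. max 0 (y - v) = 0"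
    using M(2) by eventually_elim simp
  then have "(\<integral>y. max 0 (y - v) \<partial>M) = 0"
    by (rule integral_eq_zero_AE)
  then have "CVaR \<alpha> M \<le> v"
    using CVaR_le_ru_objective[OF M(1) int \<alpha>, of v] by (simp add: ru_objective_def)
  ultimately show ?thesis by simp
qed

section \<open>Mixtures\<close>

text \<open>As a Giry bind, the mixture inherits its integration theory from the Giry monad.\<close>

definition mixture :: "real \<Rightarrow> real measure \<Rightarrow> real measure \<Rightarrow> real measure" where
  "mixture p M N = measure_pmf (bernoulli_pmf p) \<bind> (\<lambda>b. if b then M else N)"

context
  fixes p :: real and M N :: "real measure"
  assumes p: "0 \<le> p" "p \<le> 1" and MN: "real_distribution M" "real_distribution N"
begin

interpretation M: real_distribution M by (rule MN)
interpretation N: real_distribution N by (rule MN)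

lemma mixture_kernel:
  "(\<lambda>b. if b then M else N) \<in> measurable (measure_pmf (bernoulli_pmf p)) (subprob_algebra borel)"
  by (auto simp: space_subprob_algebra M.prob_space_axioms N.prob_space_axioms prob_space_imp_subprob_space)

lemma real_distribution_mixture: "real_distribution (mixture p M N)"
proof -
  have "prob_space (mixture p M N)"
    unfolding mixture_def
    by (rule prob_space.prob_space_bind[OF prob_space_measure_pmf _ mixture_kernel])
       (auto simp: M.prob_space_axioms N.prob_space_axioms)
  moreover have "sets (mixture p M N) = sets borel"
    unfolding mixture_def by (rule sets_bind) auto
  ultimately show ?thesis
    by (simp add: real_distribution_def real_distribution_axioms_def)
qed

lemma nn_integral_mixture:
  assumes "f \<in> borel_measurable borel"
  shows "(\<integral>\<^sup>+y. f y \<partial>mixture p M N) =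
    ennreal p * (\<integral>\<^sup>+y. f y \<partial>M) + ennreal (1 - p) * (\<integral>\<^sup>+y. f y \<partial>N)"
  unfolding mixture_def using p
  by (subst nn_integral_bind[OF assms mixture_kernel]) (simp add: mult.commute)

lemma emeasure_mixture:
  assumes "A \<in> sets borel"
  shows "emeasure (mixture p M N) A = ennreal p * emeasure M A + ennreal (1 - p) * emeasure N A"
proof -
  interpret real_distribution "mixture p M N" by (rule real_distribution_mixture)
  show ?thesis
    using nn_integral_mixture[of "indicator A"] assms by simp
qed

lemma AE_mixture:
  assumes "AE y in M. P y" "AE y in N. P y" "Measurable.pred borel P"
  shows "AE y in mixture p M N. P y"
  unfolding mixture_def
  using assms by (subst AE_bind[OF mixture_kernel]) (auto intro!: AE_I2)

lemma integral_mixture: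
  fixes f :: "real \<Rightarrow> real"
  assumes "integrable M f" "integrable N f" "\<And>y. 0 \<le> f y" "f \<in> borel_measurable borel"
  shows "integrable (mixture p M N) f"
    and "(\<integral>y. f y \<partial>mixture p M N) = p * (\<integral>y. f y \<partial>M) + (1 - p) * (\<integral>y. f y \<partial>N)"
proof -
  interpret real_distribution "mixture p M N" by (rule real_distribution_mixture)
  have "(\<integral>\<^sup>+y. ennreal (f y) \<partial>mixture p M N) =
      ennreal (p * (\<integral>y. f y \<partial>M) + (1 - p) * (\<integral>y. f y \<partial>N))"
    using assms p
    by (simp add: nn_integral_mixture nn_integral_eq_integral ennreal_plus ennreal_mult integral_nonneg)
  then have "has_bochner_integral (mixture p M N) f
      (p * (\<integral>y. f y \<partial>M) + (1 - p) * (\<integral>y. f y \<partial>N))"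
    using assms p
    by (intro has_bochner_integral_nn_integral)
       (auto intro!: add_nonneg_nonneg mult_nonneg_nonneg integral_nonneg)
  then show "integrable (mixture p M N) f"
    "(\<integral>y. f y \<partial>mixture p M N) = p * (\<integral>y. f y \<partial>M) + (1 - p) * (\<integral>y. f y \<partial>N)"
    by (auto simp: has_bochner_integral_iff)
qed

lemma ru_objective_mixture:
  assumes "integrable M (\<lambda>y. max 0 y)" "integrable N (\<lambda>y. max 0 y)"
  shows "ru_objective \<alpha> (mixture p M N) x = p * ru_objective \<alpha> M x + (1 - p) * ru_objective \<alpha> N x"
proof -
  have int: "(\<integral>y. max 0 (y - x) \<partial>mixture p M N) =
      p * (\<integral>y. max 0 (y - x) \<partial>M) + (1 - p) * (\<integral>y. max 0 (y - x) \<partial>N)"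
    using integrable_excess MN assms by (intro integral_mixture(2)) auto
  show ?thesis
    unfolding ru_objective_def int by (simp add: add_divide_distrib diff_divide_distrib algebra_simps)
qed

end

text \<open>The source of non-elicitability. At a quantile \<open>q\<close> of the mixture, the CVaR of the mixture
  is a weighted mean of the two objectives at \<open>q\<close>. Each is at least \<open>t\<close>, and as \<open>q\<close> is not a common
  quantile one of them is larger.\<close>

lemma CVaR_mixture_greater:
  assumes M: "real_distribution M" "integrable M (\<lambda>y. max 0 y)"
    and N: "real_distribution N" "integrable N (\<lambda>y. max 0 y)"
    and \<alpha>: "0 < \<alpha>" "\<alpha> < 1" and p: "0 < p" "p < 1"
    and t: "CVaR \<alpha> M = t" "CVaR \<alpha> N = t"
    and no_common_quantile: "\<nexists>q. is_quantile M \<alpha> q \<and> is_quantile N \<alpha> q"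
  shows "t < CVaR \<alpha> (mixture p M N)"
proof -
  have mix: "real_distribution (mixture p M N)"
    using real_distribution_mixture[OF _ _ M(1) N(1)] p by simp
  define q where "q = quantile (mixture p M N) \<alpha>"
  have q: "is_quantile (mixture p M N) \<alpha> q"
    unfolding q_def using is_quantile_quantile[OF mix \<alpha>] .
  have "integrable (mixture p M N) (\<lambda>y. max 0 y)"
    using integral_mixture(1)[OF _ _ M(1) N(1) M(2) N(2)] p by simp
  then have eq: "CVaR \<alpha> (mixture p M N) = p * ru_objective \<alpha> M q + (1 - p) * ru_objective \<alpha> N q"
    using CVaR_eq_ru_objective[OF mix _ \<alpha> q] ru_objective_mixture[OF _ _ M(1) N(1) M(2) N(2)] p
    by simp
  have le: "t \<le> ru_objective \<alpha> M q" "t \<le> ru_objective \<alpha> N q"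
    using CVaR_le_ru_objective[OF M \<alpha>] CVaR_le_ru_objective[OF N \<alpha>] t by auto
  have less: "t < ru_objective \<alpha> M q \<or> t < ru_objective \<alpha> N q"
    using CVaR_less_ru_objective[OF M \<alpha>] CVaR_less_ru_objective[OF N \<alpha>] t no_common_quantile by auto
  have "0 < p * (ru_objective \<alpha> M q - t) + (1 - p) * (ru_objective \<alpha> N q - t)"
    using less
  proof
    assume "t < ru_objective \<alpha> M q"
    then show ?thesis
      using p le by (intro add_pos_nonneg mult_pos_pos mult_nonneg_nonneg) auto
  next
    assume "t < ru_objective \<alpha> N q"
    then show ?thesis
      using p le by (intro add_nonneg_pos mult_pos_pos mult_nonneg_nonneg) auto
  qed
  then show ?thesis
    unfolding eq by (simp add: algebra_simps)
qed

section \<open>Elicitability forces convex level sets\<close>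

lemma expected_score_mixture:
  assumes S: "scoring_function I S" and I: "I \<in> sets borel" and x: "x \<in> I"
    and p: "0 \<le> p" "p \<le> 1" and MN: "real_distribution M" "real_distribution N"
  shows "expected_score I S (mixture p M N) x =
    ennreal p * expected_score I S M x + ennreal (1 - p) * expected_score I S N x"
proof -
  have "(\<lambda>y. ennreal (S x y)) \<in> borel_measurable (restrict_space borel I)"
    using S x by (intro measurable_compose[OF _ measurable_ennreal]) (auto simp: scoring_function_def)
  then have "(\<lambda>y. ennreal (S x y) * indicator I y) \<in> borel_measurable borel"
    using I by (simp add: borel_measurable_restrict_space_iff_ennreal)
  then show ?thesis
    unfolding expected_score_def by (rule nn_integral_mixture[OF p MN])
qed

text \<open>If the value at the mixture were \<open>x \<noteq> t\<close>, both components would give \<open>t\<close> a strictly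
  smaller expected score than \<open>x\<close>, hence so would the mixture. The strict inequalities already force
  the expected scores of \<open>t\<close> to be finite, so infinite scores cause no trouble when they are added.
  The value at the mixture has to lie in \<open>I\<close> to be an admissible competitor for the components.\<close>

lemma strictly_consistent_mixture:
  assumes S: "scoring_function I S" "strictly_consistent I \<F> T S" and I: "I \<in> sets borel"
    and FG: "real_distribution F" "real_distribution G" "F \<in> \<F>" "G \<in> \<F>" "mixture p F G \<in> \<F>"
    and p: "0 < p" "p < 1"
    and t: "T F = t" "T G = t" "t \<in> I" and range_mixture: "T (mixture p F G) \<in> I"
  shows "T (mixture p F G) = t"
proof (rule ccontr)
  define x where "x = T (mixture p F G)"
  assume "\<not> ?thesis"
  then have "x \<noteq> t" by (simp add: x_def)
  have xI: "x \<in> I" using range_mixture by (simp add: x_def)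
  have less: "expected_score I S F t < expected_score I S F x"
    "expected_score I S G t < expected_score I S G x"
    using S(2) FG(3,4) t xI \<open>x \<noteq> t\<close> unfolding strictly_consistent_def by (metis order_le_less)+
  have mix: "expected_score I S (mixture p F G) z =
      ennreal p * expected_score I S F z + ennreal (1 - p) * expected_score I S G z" if "z \<in> I" for z
    using expected_score_mixture[OF S(1) I that _ _ FG(1,2)] p by simp
  have "ennreal p * expected_score I S F t + ennreal (1 - p) * expected_score I S G t
      < ennreal p * expected_score I S F x + ennreal (1 - p) * expected_score I S G x"
    using less p by (intro add_strict_mono ennreal_mult_strict_left_mono) auto
  then have "expected_score I S (mixture p F G) t < expected_score I S (mixture p F G) x"
    using mix t(3) xI by simp
  moreover have "expected_score I S (mixture p F G) x \<le> expected_score I S (mixture p F G) t"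
    using S(2) FG(5) t(3) unfolding strictly_consistent_def x_def by blast
  ultimately show False by simp
qed

lemma not_elicitable_CVaR:
  assumes \<alpha>: "0 < \<alpha>" "\<alpha> < 1" and I: "I \<in> sets borel" "{u..v} \<subseteq> I"
    and F: "real_distribution F" "AE y in F. y \<in> {u..v}" "F \<in> \<F>"
    and G: "real_distribution G" "AE y in G. y \<in> {u..v}" "G \<in> \<F>"
    and p: "0 < p" "p < 1" and mix: "mixture p F G \<in> \<F>"
    and eq: "CVaR \<alpha> F = CVaR \<alpha> G"
    and no_common_quantile: "\<nexists>q. is_quantile F \<alpha> q \<and> is_quantile G \<alpha> q"
  shows "\<not> elicitable I \<F> (CVaR \<alpha>)"
proof
  assume "elicitable I \<F> (CVaR \<alpha>)"
  then obtain S where S: "scoring_function I S" "strictly_consistent I \<F> (CVaR \<alpha>) S"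
    by (auto simp: elicitable_def)
  have range: "CVaR \<alpha> F \<in> I"
    using CVaR_in_interval[OF F(1,2) \<alpha>] I(2) by blast
  have "real_distribution (mixture p F G)" "AE y in mixture p F G. y \<in> {u..v}"
    using real_distribution_mixture[OF _ _ F(1) G(1)] AE_mixture[OF _ _ F(1) G(1) F(2) G(2)] p
    by auto
  then have range_mixture: "CVaR \<alpha> (mixture p F G) \<in> I"
    using CVaR_in_interval[OF _ _ \<alpha>] I(2) by blast
  have "CVaR \<alpha> (mixture p F G) = CVaR \<alpha> F"
    by (rule strictly_consistent_mixture[OF S I(1) F(1) G(1) F(3) G(3) mix p refl eq[symmetric]
          range range_mixture])
  moreover have "AE y in F. y \<le> v"
    using F(2) by eventually_elim simp
  then have "integrable F (\<lambda>y. max 0 y)"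
    by (rule integrable_max_if_bounded_above[OF F(1)])
  moreover have "AE y in G. y \<le> v"
    using G(2) by eventually_elim simp
  then have "integrable G (\<lambda>y. max 0 y)"
    by (rule integrable_max_if_bounded_above[OF G(1)])
  ultimately show False
    using CVaR_mixture_greater[OF F(1) _ G(1) _ \<alpha> p _ _ no_common_quantile] eq by fastforce
qed

section \<open>Supports\<close>

lemma distributions_onI:
  assumes "real_distribution M" "AE y in M. y \<in> K" "K \<subseteq> I" "I \<in> sets borel"
  shows "M \<in> distributions_on I"
proof -
  interpret real_distribution M by fact
  have "AE y in M. y \<in> I"
    using assms(2,3) by (auto elim!: eventually_mono)
  then have "measure M I = 1"
    using assms(4) by (intro prob_eq_1[THEN iffD2]) auto
  with assms(1) show ?thesis by (simp add: distributions_on_def)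
qed

lemma measure_support_subset:
  assumes "real_distribution M" "AE y in M. y \<in> K" "closed K"
  shows "measure_support M \<subseteq> K"
proof
  interpret real_distribution M by fact
  fix x assume x: "x \<in> measure_support M"
  have "measure M (- K) = 0"
    using assms by (intro measure_eq_0_null_sets AE_iff_null_sets[THEN iffD2]) auto
  then show "x \<in> K"
    using x assms(3) unfolding measure_support_def
    by (metis (mono_tags, lifting) ComplI less_irrefl mem_Collect_eq open_Compl)
qed

lemma closed_measure_support: "closed (measure_support M)"
proof -
  have "- measure_support M = \<Union>{U. open U \<and> \<not> measure M U > 0}"
    by (auto simp: measure_support_def)
  then have "open (- measure_support M)"
    by (simp only:) (rule open_Union, auto)
  then show ?thesis by (simp add: closed_def)
qed

text \<open>It suffices to know one finite set of full measure, as it contains the support.\<close>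

lemma finite_support_distributionsI:
  assumes "real_distribution M" "AE y in M. y \<in> K" "finite K" "K \<subseteq> I" "I \<in> sets borel"
  shows "M \<in> finite_support_distributions I"
  using distributions_onI[OF assms(1,2,4,5)] measure_support_subset[OF assms(1,2)] assms
    finite_imp_closed finite_subset
  unfolding finite_support_distributions_def by blast

lemma ac_compact_support_distributionsI:
  assumes "real_distribution M" "AE y in M. y \<in> K" "compact K" "K \<subseteq> I" "I \<in> sets borel"
    and "absolutely_continuous lborel M"
  shows "M \<in> ac_compact_support_distributions I"
proof -
  have sub: "measure_support M \<subseteq> K"
    using assms by (intro measure_support_subset compact_imp_closed)
  then have "compact (measure_support M)"
    using compact_Int_closed[OF assms(3) closed_measure_support[of M]] by (simp add: Int_absorb1)
  then show ?thesis
    using sub distributions_onI[OF assms(1,2,4,5)] assms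
    unfolding ac_compact_support_distributions_def by blast
qed

section \<open>Point masses and two-point distributions\<close>

lemma real_distribution_return: "real_distribution (return borel a)"
  by (simp add: real_distribution_def real_distribution_axioms_def prob_space_return)

lemma is_quantile_return:
  assumes "0 < \<beta>" "\<beta> < 1" "is_quantile (return borel a) \<beta> x"
  shows "x = a"
  using assms by (cases x a rule: linorder_cases)
    (auto simp: is_quantile_iff[OF real_distribution_return] measure_return)

lemma CVaR_return:
  assumes "0 < \<alpha>" "\<alpha> < 1"
  shows "CVaR \<alpha> (return borel a) = a"
  using CVaR_in_interval[OF real_distribution_return _ assms, of a a a] by (simp add: AE_return)

lemma measure_two_point:
  assumes "0 \<le> p" "p \<le> 1" "A \<in> sets borel"
  shows "measure (mixture p (return borel a) (return borel b)) A = p * indicator A a + (1 - p) * indicator A b"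
  using emeasure_mixture[OF assms(1,2) real_distribution_return real_distribution_return assms(3), of a b] assms
  by (auto simp: measure_def indicator_def enn2real_plus ennreal_plus[symmetric] simp del: ennreal_plus)

lemma is_quantile_two_point:
  assumes "0 < \<beta>" "\<beta> < p" "p < 1" "a < b"
  shows "is_quantile (mixture p (return borel a) (return borel b)) \<beta> x \<longleftrightarrow> x = a"
  using assms real_distribution_mixture[OF _ _ real_distribution_return real_distribution_return, of p a b]
  by (auto simp: is_quantile_iff measure_two_point indicator_def split: if_splits)

text \<open>As \<open>\<alpha> < p\<close>, the \<open>\<alpha>\<close>-quantile is \<open>a\<close>, so the objective is evaluated there.\<close>

lemma CVaR_two_point:
  assumes "0 < \<alpha>" "\<alpha> < p" "p < 1" "a < b"
  shows "CVaR \<alpha> (mixture p (return borel a) (return borel b)) = a + (1 - p) / (1 - \<alpha>) * (b - a)"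
proof -
  let ?D = "return borel :: real \<Rightarrow> real measure"
  have int: "integrable (?D c) (\<lambda>y. max 0 y)" for c
    by (rule integrable_max_if_bounded_above[OF real_distribution_return, where v=c])
       (simp add: AE_return)
  have D: "real_distribution (mixture p (?D a) (?D b))"
    using assms by (intro real_distribution_mixture real_distribution_return) auto
  have "integrable (mixture p (?D a) (?D b)) (\<lambda>y. max 0 y)"
    using assms int by (intro integral_mixture real_distribution_return) auto
  then have "CVaR \<alpha> (mixture p (?D a) (?D b)) = ru_objective \<alpha> (mixture p (?D a) (?D b)) a"
    using D assms is_quantile_two_point[of \<alpha> p a b a] by (intro CVaR_eq_ru_objective) auto
  also have "\<dots> = p * ru_objective \<alpha> (?D a) a + (1 - p) * ru_objective \<alpha> (?D b) a"
    using assms int by (intro ru_objective_mixture real_distribution_return) auto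
  also have "\<dots> = a + (1 - p) / (1 - \<alpha>) * (b - a)"
    using assms by (simp add: ru_objective_def integral_return field_simps)
  finally show ?thesis .
qed

lemma not_elicitable_CVaR_finite_support:
  assumes \<alpha>: "0 < \<alpha>" "\<alpha> < 1" and I: "I \<in> sets borel" "{a..b} \<subseteq> I" "a < b"
    and \<F>: "finite_support_distributions I \<subseteq> \<F>"
  shows "\<not> elicitable I \<F> (CVaR \<alpha>)"
proof -
  let ?D = "return borel :: real \<Rightarrow> real measure"
  define c where "c = (a + b) / 2"
  \<comment> \<open>The value of \<open>p\<close> for which the upper tail of mass \<open>1 - \<alpha>\<close> is shared equally by \<open>a\<close> and \<open>b\<close>.\<close>
  define p where "p = (1 + \<alpha>) / 2"
  define G where "G = mixture p (?D a) (?D b)"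
  have c: "a < c" "c < b" and p: "\<alpha> < p" "0 < p" "p < 1"
    using I(3) \<alpha> by (auto simp: c_def p_def)
  have G: "real_distribution G"
    unfolding G_def using p by (intro real_distribution_mixture real_distribution_return) auto
  have AE_F: "AE y in ?D c. y \<in> {a, b, c}"
    by (simp add: AE_return)
  have AE_G: "AE y in G. y \<in> {a, b, c}"
    unfolding G_def using p by (intro AE_mixture real_distribution_return) (auto simp: AE_return)
  have mix: "real_distribution (mixture (1/2) (?D c) G)"
    by (intro real_distribution_mixture real_distribution_return G) auto
  have AE_mix: "AE y in mixture (1/2) (?D c) G. y \<in> {a, b, c}"
    using AE_F AE_G by (intro AE_mixture real_distribution_return G) auto
  have in_\<F>: "M \<in> \<F>" if "real_distribution M" "AE y in M. y \<in> {a, b, c}" for M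
  proof -
    have "{a, b, c} \<subseteq> I"
      using c I(2) by (auto intro!: subsetD[OF I(2)])
    then show ?thesis
      using finite_support_distributionsI[OF that _ _ I(1)] \<F> by auto
  qed
  show ?thesis
  proof (rule not_elicitable_CVaR[OF \<alpha> I(1,2), where F="?D c" and G=G and p="1/2"])
    show "AE y in ?D c. y \<in> {a..b}" "AE y in G. y \<in> {a..b}"
      using AE_F AE_G c by (auto elim!: eventually_mono)
    show "CVaR \<alpha> (?D c) = CVaR \<alpha> G"
    proof -
      have "(1 - p) / (1 - \<alpha>) = 1 / 2"
        using \<alpha> by (simp add: p_def field_simps)
      then have "CVaR \<alpha> G = a + 1 / 2 * (b - a)"
        using CVaR_two_point[of \<alpha> p a b] \<alpha> p I(3) by (simp only: G_def)
      then show ?thesis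
        by (simp add: CVaR_return[OF \<alpha>] c_def field_simps)
    qed
    show "\<nexists>q. is_quantile (?D c) \<alpha> q \<and> is_quantile G \<alpha> q"
      using is_quantile_return[OF \<alpha>] is_quantile_two_point[of \<alpha> p a b] \<alpha> p I(3) c
      by (auto simp: G_def)
  qed (use in_\<F> AE_F AE_G AE_mix G mix real_distribution_return in auto)
qed

section \<open>Uniform distributions\<close>

abbreviation uniform_on :: "real \<Rightarrow> real \<Rightarrow> real measure" where
  "uniform_on a b \<equiv> uniform_measure lborel {a..b}"

lemma real_distribution_uniform_on: "a < b \<Longrightarrow> real_distribution (uniform_on a b)"
  by (auto simp: real_distribution_def real_distribution_axioms_def intro!: prob_space_uniform_measure)

lemma AE_uniform_on: "AE y in uniform_on a b. y \<in> {a..b}"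
  by (intro AE_uniform_measureI) auto

lemma absolutely_continuous_uniform_on: "absolutely_continuous lborel (uniform_on a b)"
  unfolding uniform_measure_def by (intro absolutely_continuousI_density) auto

lemma is_quantile_uniform_on:
  assumes "a < b" "0 < \<beta>" "\<beta> < 1" "is_quantile (uniform_on a b) \<beta> x"
  shows "x = a + \<beta> * (b - a)"
proof -
  have below: "{a..b} \<inter> {..x} = {a..min b x}" "{a..b} \<inter> {..<x} = (if x \<le> b then {a..<x} else {a..b})"
    by auto
  have measure: "measure (uniform_on a b) {..x} = measure lborel {a..min b x} / (b - a)"
    "measure (uniform_on a b) {..<x} = measure lborel (if x \<le> b then {a..<x} else {a..b}) / (b - a)"
    using assms(1) by (simp_all add: measure_uniform_measure below)
  have "measure lborel (if x \<le> b then {a..<x} else {a..b}) / (b - a) \<le> \<beta>"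
    "\<beta> \<le> measure lborel {a..min b x} / (b - a)"
    using assms(4) unfolding is_quantile_iff[OF real_distribution_uniform_on[OF assms(1)]] measure
    by auto
  moreover have "\<beta> * (b - a) < b - a"
    using assms(1-3) by simp
  ultimately show ?thesis
    using assms(1,2) by (auto simp: field_simps min_def split: if_splits)
qed

text \<open>For levels in the open unit interval the quantile function is affine, so the integral is
  elementary.\<close>

lemma CVaR_uniform_on:
  assumes "a < b" "0 < \<alpha>" "\<alpha> < 1"
  shows "CVaR \<alpha> (uniform_on a b) = a + (1 + \<alpha>) / 2 * (b - a)"
proof -
  have quantile: "quantile (uniform_on a b) \<beta> = a + \<beta> * (b - a)" if "0 < \<beta>" "\<beta> < 1" for \<beta>
    using is_quantile_uniform_on is_quantile_quantile real_distribution_uniform_on assms that by blast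
  have "(LBINT \<beta>:{\<alpha><..<1}. quantile (uniform_on a b) \<beta>) = (LBINT \<beta>:{\<alpha><..<1}. a + \<beta> * (b - a))"
    using assms by (intro set_lebesgue_integral_cong) (auto simp: quantile)
  also have "\<dots> = (LBINT \<beta>=\<alpha>..1. a + \<beta> * (b - a))"
    using assms by (simp add: interval_integral_Ioo one_ereal_def)
  also have "\<dots> = (a * 1 + 1\<^sup>2 / 2 * (b - a)) - (a * \<alpha> + \<alpha>\<^sup>2 / 2 * (b - a))"
    unfolding one_ereal_def
    by (rule interval_integral_FTC_finite)
       (auto intro!: continuous_intros derivative_eq_intros
         simp: has_real_derivative_iff_has_vector_derivative[symmetric])
  also have "\<dots> = (1 - \<alpha>) * (a + (1 + \<alpha>) / 2 * (b - a))"
    by (simp add: field_simps power2_eq_square)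
  finally show ?thesis
    using assms by (simp add: CVaR_def)
qed

lemma finite_mixturesI:
  assumes "M \<in> C" "N \<in> C" "real_distribution M" "real_distribution N" "0 \<le> p" "p \<le> 1"
  shows "mixture p M N \<in> finite_mixtures C"
proof -
  interpret real_distribution "mixture p M N"
    using assms by (intro real_distribution_mixture)
  show ?thesis
    unfolding finite_mixtures_def
    using assms
    by (intro CollectI conjI exI[of _ "2::nat"] exI[of _ "\<lambda>i::nat. if i = 0 then p else 1 - p"]
        exI[of _ "\<lambda>i::nat. if i = 0 then M else N"])
       (auto simp: emeasure_mixture lessThan_Suc numeral_2_eq_2 add.commute)
qed

lemma finite_mixtures_superset:
  assumes "M \<in> C" "real_distribution M"
  shows "M \<in> finite_mixtures C"
proof -
  interpret real_distribution M by fact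
  show ?thesis
    unfolding finite_mixtures_def using assms(1)
    by (intro CollectI conjI exI[of _ "1::nat"] exI[of _ "\<lambda>i::nat. 1::real"] exI[of _ "\<lambda>i::nat. M"]) auto
qed

lemma not_elicitable_CVaR_ac_mixtures:
  assumes \<alpha>: "0 < \<alpha>" "\<alpha> < 1" and I: "I \<in> sets borel" "{a..b} \<subseteq> I" "a < b"
    and \<F>: "finite_mixtures (ac_compact_support_distributions I) \<subseteq> \<F>"
  shows "\<not> elicitable I \<F> (CVaR \<alpha>)"
proof -
  \<comment> \<open>Halving the length halves the distance \<open>(1 + \<alpha>) / 2 * (b - a)\<close> from the left end point to
    the CVaR, so moving the left end point by the other half keeps the CVaR.\<close>
  define h where "h = (1 + \<alpha>) / 4 * (b - a)"
  define c where "c = a + h"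
  define d where "d = c + (b - a) / 2"
  have h: "h < 1 / 2 * (b - a)"
    unfolding h_def using \<alpha> I(3) by (intro mult_strict_right_mono) auto
  have h_pos: "0 < h"
    unfolding h_def using \<alpha> I(3) by (intro mult_pos_pos) auto
  have cd: "a < c" "c < d" "d < b"
    using h h_pos I(3) by (simp_all add: d_def c_def field_simps)
  have F: "real_distribution (uniform_on a b)" and G: "real_distribution (uniform_on c d)"
    using I(3) cd by (auto intro: real_distribution_uniform_on)
  have AE_F: "AE y in uniform_on a b. y \<in> {a..b}"
    by (rule AE_uniform_on)
  have AE_G: "AE y in uniform_on c d. y \<in> {a..b}"
    using AE_uniform_on[of c d] by eventually_elim (use cd in auto)
  have ac: "uniform_on a b \<in> ac_compact_support_distributions I"
    "uniform_on c d \<in> ac_compact_support_distributions I"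
    using ac_compact_support_distributionsI[OF F AE_F] ac_compact_support_distributionsI[OF G AE_G]
      I absolutely_continuous_uniform_on by auto
  show ?thesis
  proof (rule not_elicitable_CVaR[OF \<alpha> I(1,2) F AE_F _ G AE_G, where p="1/2"])
    show "uniform_on a b \<in> \<F>" "uniform_on c d \<in> \<F>" "mixture (1/2) (uniform_on a b) (uniform_on c d) \<in> \<F>"
      using finite_mixtures_superset[OF ac(1) F] finite_mixtures_superset[OF ac(2) G]
        finite_mixturesI[OF ac F G, of "1/2"] \<F> by auto
    show "CVaR \<alpha> (uniform_on a b) = CVaR \<alpha> (uniform_on c d)"
      using I(3) cd \<alpha> by (simp add: CVaR_uniform_on d_def) (simp add: c_def h_def field_simps)
    show "\<nexists>q. is_quantile (uniform_on a b) \<alpha> q \<and> is_quantile (uniform_on c d) \<alpha> q"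
    proof
      assume "\<exists>q. is_quantile (uniform_on a b) \<alpha> q \<and> is_quantile (uniform_on c d) \<alpha> q"
      then have "a + \<alpha> * (b - a) = c + \<alpha> * (d - c)"
        using is_quantile_uniform_on[OF I(3) \<alpha>] is_quantile_uniform_on[OF cd(2) \<alpha>] by metis
      then have "(1 - \<alpha>) * (b - a) = 0"
        by (simp add: c_def d_def h_def field_simps)
      then show False
        using \<alpha> I(3) by simp
    qed
  qed auto
qed

theorem theorem3p5:
  fixes \<alpha> :: real and I :: "real set" and \<F> :: "real measure set"
  assumes "0 < \<alpha>" and "\<alpha> < 1"
    and "is_interval I" and "\<exists>a\<in>I. \<exists>b\<in>I. a < b"
    and "\<F> \<subseteq> distributions_on I"
    and "\<forall>F\<in>\<F>. CVaR_defined \<alpha> F"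
    and "finite_support_distributions I \<subseteq> \<F> \<or>
         finite_mixtures (ac_compact_support_distributions I) \<subseteq> \<F>"
  shows "\<not> elicitable I \<F> (CVaR \<alpha>)"
proof -
  obtain a b where a: "a \<in> I" and b: "b \<in> I" and ab: "a < b"
    using assms(4) by blast
  have sub: "{a..b} \<subseteq> I"
    using mem_is_interval_1_I[OF assms(3) a b] by (intro subsetI) simp
  have I: "I \<in> sets borel"
    using assms(3) by (rule real_interval_borel_measurable)
  show ?thesis
    using assms(7)
  proof
    assume "finite_support_distributions I \<subseteq> \<F>"
    then show ?thesis
      by (rule not_elicitable_CVaR_finite_support[OF assms(1,2) I sub ab])
  next
    assume "finite_mixtures (ac_compact_support_distributions I) \<subseteq> \<F>"
    then show ?thesis
      by (rule not_elicitable_CVaR_ac_mixtures[OF assms(1,2) I sub ab])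
  qed
qed

end
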